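(* Let $\alpha\in(0,1)$ and $U=\prod_{i=1}^d[0,b_i]\subset\mathbb{R}^d$ with all $b_i>0$. For every $p\ge0$ and every $\omega\in\Omega_\alpha^p(U;\mathscr{P}_\alpha)$ one has $$(d^\alpha)^2\omega=0.$$
   Context: Let $X_i^\alpha(x)=x_i^\alpha/\Gamma(1+\alpha)$ and $\mathscr{P}_\alpha(U)=\mathbb{R}[X_1^\alpha,\dots,X_d^\alpha]$, the algebra of functions on $U$ generated by the $X_i^\alpha$. These functions are algebraically independent, so each element is uniquely a finite linear combination of monomials. The polynomial Caputo operator $\mathsf{D}_i^\alpha:\mathscr{P}_\alpha(U)\to\mathscr{P}_\alpha(U)$ is the $\mathbb{R}$-linear map defined on monomials $M=\prod_{k=1}^d(X_k^\alpha)^{m_k}$, $m_k\in\mathbb{Z}_{\ge0}$, by $$\mathsf{D}_i^\alpha M=\frac{\Gamma(m_i\alpha+1)}{\Gamma((m_i-1)\alpha+1)\Gamma(1+\alpha)}(X_i^\alpha)^{m_i-1}\prod_{j\ne i}(X_j^\alpha)^{m_j}\ \text{ if } m_i\ge1,\qquad \mathsf{D}_i^\alpha M=0\ \text{ if } m_i=0.$$ Let $d^\alpha X_1,\dots,d^\alpha X_d$ be formal degree-one generators with $d^\alpha X_i\wedge d^\alpha X_j=-d^\alpha X_j\wedge d^\alpha X_i$ and $d^\alpha X_i\wedge d^\alpha X_i=0$. For $I=(i_1<\dots<i_p)$ put $d^\alpha X_I=d^\alpha X_{i_1}\wedge\cdots\wedge d^\alpha X_{i_p}$ and $\Omega_\alpha^p(U;\mathscr{P}_\alpha)=\bigoplus_{|I|=p}\mathscr{P}_\alpha(U)\,d^\alpha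 X_I$ (the degree-$p$ part of the exterior algebra over $\mathscr{P}_\alpha(U)$ on these generators). The fractional exterior differential $d^\alpha:\Omega_\alpha^p\to\Omega_\alpha^{p+1}$ is $$d^\alpha\Bigl(\sum_{|I|=p}a_I\,d^\alpha X_I\Bigr)=\sum_{|I|=p}\sum_{i=1}^d(\mathsf{D}_i^\alpha a_I)\,d^\alpha X_i\wedge d^\alpha X_I .$$ *)

theory Defs
  imports "HOL-Analysis.Analysis" "HOL-Library.Function_Algebras"
begin

text \<open>
  Function spaces carry the pointwise ring operations of \<^theory>\<open>HOL-Library.Function_Algebras\<close>.
  A function on \<open>U\<close> is represented by its extension by zero to the whole space, so the unit
  of the algebra of functions on \<open>U\<close> is \<open>indicator U\<close>.
\<close>

subsection \<open>Fractional polynomials\<close>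

definition frac_X :: "real \<Rightarrow> (real ^ 'n) set \<Rightarrow> 'n::finite \<Rightarrow> real ^ 'n \<Rightarrow> real"
  where "frac_X \<alpha> U i = (\<lambda>x. if x \<in> U then (x $ i) powr \<alpha> / Gamma (1 + \<alpha>) else 0)"

inductive_set frac_poly :: "real \<Rightarrow> (real ^ 'n::finite) set \<Rightarrow> (real ^ 'n \<Rightarrow> real) set"
  for \<alpha> :: real and U :: "(real ^ 'n) set"
  where
    const: "(\<lambda>x. if x \<in> U then c else 0) \<in> frac_poly \<alpha> U"
  | gen: "frac_X \<alpha> U i \<in> frac_poly \<alpha> U"
  | add: "f \<in> frac_poly \<alpha> U \<Longrightarrow> g \<in> frac_poly \<alpha> U \<Longrightarrow> f + g \<in> frac_poly \<alpha> U"
  | mult: "f \<in> frac_poly \<alpha> U \<Longrightarrow> g \<in> frac_poly \<alpha> U \<Longrightarrow> f * g \<in> frac_poly \<alpha> U"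

definition frac_mon :: "real \<Rightarrow> (real ^ 'n) set \<Rightarrow> ('n::finite \<Rightarrow> nat) \<Rightarrow> real ^ 'n \<Rightarrow> real"
  where "frac_mon \<alpha> U m = indicator U * (\<Prod>k\<in>UNIV. frac_X \<alpha> U k ^ m k)"

definition frac_lincomb ::
  "real \<Rightarrow> (real ^ 'n) set \<Rightarrow> (('n::finite \<Rightarrow> nat) \<Rightarrow> real) \<Rightarrow> real ^ 'n \<Rightarrow> real"
  where "frac_lincomb \<alpha> U c = (\<lambda>x. \<Sum>m | c m \<noteq> 0. c m * frac_mon \<alpha> U m x)"

text \<open>
  The coefficients of an element of \<open>frac_poly \<alpha> U\<close> with respect to the monomials. They exist
  and are unique when \<open>U\<close> is a nondegenerate box, see \<open>frac_coeffs_unique\<close>.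
\<close>

definition frac_coeffs ::
  "real \<Rightarrow> (real ^ 'n) set \<Rightarrow> (real ^ 'n \<Rightarrow> real) \<Rightarrow> ('n::finite \<Rightarrow> nat) \<Rightarrow> real"
  where "frac_coeffs \<alpha> U f = (THE c. finite {m. c m \<noteq> 0} \<and> f = frac_lincomb \<alpha> U c)"

definition caputo_mon ::
  "real \<Rightarrow> (real ^ 'n) set \<Rightarrow> 'n::finite \<Rightarrow> ('n \<Rightarrow> nat) \<Rightarrow> real ^ 'n \<Rightarrow> real"
  where "caputo_mon \<alpha> U i m =
    (if m i = 0 then 0
     else (\<lambda>x. Gamma (real (m i) * \<alpha> + 1) / (Gamma ((real (m i) - 1) * \<alpha> + 1) * Gamma (1 + \<alpha>))
                * frac_mon \<alpha> U (m(i := m i - 1)) x))"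

text \<open>The linear extension of \<open>caputo_mon\<close>, see \<open>caputo_frac_mon\<close> and \<open>caputo_linear\<close>.\<close>

definition caputo ::
  "real \<Rightarrow> (real ^ 'n) set \<Rightarrow> 'n::finite \<Rightarrow> (real ^ 'n \<Rightarrow> real) \<Rightarrow> real ^ 'n \<Rightarrow> real"
  where "caputo \<alpha> U i f =
    (\<lambda>x. \<Sum>m | frac_coeffs \<alpha> U f m \<noteq> 0. frac_coeffs \<alpha> U f m * caputo_mon \<alpha> U i m x)"

subsection \<open>Forms\<close>

text \<open>
  A form \<open>\<Sum>\<^sub>I a\<^sub>I dX\<^sub>I\<close> is represented by its coefficient family \<open>I \<mapsto> a\<^sub>I\<close>. A strictly
  increasing multi-index is identified with the set of its entries.
\<close>

type_synonym 'n frac_form = "'n set \<Rightarrow> real ^ 'n \<Rightarrow> real"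

definition frac_forms :: "real \<Rightarrow> (real ^ 'n::finite) set \<Rightarrow> nat \<Rightarrow> 'n frac_form set"
  where "frac_forms \<alpha> U p =
    {\<omega>. (\<forall>I. \<omega> I \<in> frac_poly \<alpha> U) \<and> (\<forall>I. card I \<noteq> p \<longrightarrow> \<omega> I = 0)}"

definition form_scale :: "(real ^ 'n \<Rightarrow> real) \<Rightarrow> 'n::finite frac_form \<Rightarrow> 'n frac_form"
  where "form_scale a \<omega> = (\<lambda>I. a * \<omega> I)"

text \<open>
  For disjoint \<open>I\<close> and \<open>J\<close> this is the sign of the permutation that sorts the concatenation
  of the increasing enumerations of \<open>I\<close> and \<open>J\<close>.
\<close>

definition shuffle_sign :: "'n::linorder set \<Rightarrow> 'n set \<Rightarrow> 'a::comm_ring_1"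
  where "shuffle_sign I J = (- 1) ^ card {(i, j). i \<in> I \<and> j \<in> J \<and> j < i}"

definition form_wedge ::
  "'n::{finite, linorder} frac_form \<Rightarrow> 'n frac_form \<Rightarrow> 'n frac_form"  (infixr "\<and>\<^sub>F" 70)
  where "\<omega> \<and>\<^sub>F \<eta> = (\<lambda>K. \<Sum>I\<in>Pow K. shuffle_sign I (K - I) * \<omega> I * \<eta> (K - I))"

text \<open>
  The basis form \<open>dX\<^sub>I\<close>. By \<open>form_dXs_increasing\<close> it is the wedge product of the generators
  \<open>dX\<^sub>i\<close>, \<open>i \<in> I\<close>, in increasing order.
\<close>

definition form_dXs :: "(real ^ 'n) set \<Rightarrow> 'n::finite set \<Rightarrow> 'n frac_form"
  where "form_dXs U I = (\<lambda>J. if J = I then indicator U else 0)"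

abbreviation form_dX :: "(real ^ 'n) set \<Rightarrow> 'n::finite \<Rightarrow> 'n frac_form"
  where "form_dX U i \<equiv> form_dXs U {i}"

definition frac_d ::
  "real \<Rightarrow> (real ^ 'n::{finite, linorder}) set \<Rightarrow> nat \<Rightarrow> 'n frac_form \<Rightarrow> 'n frac_form"
  where "frac_d \<alpha> U p \<omega> =
    (\<Sum>I | card I = p. \<Sum>i\<in>UNIV.
      form_scale (caputo \<alpha> U i (\<omega> I)) (form_dX U i \<and>\<^sub>F form_dXs U I))"

subsection \<open>Well-definedness of the coefficients and of the Caputo operators\<close>

lemma sum_fun_apply: "(\<Sum>i\<in>A. f i) x = (\<Sum>i\<in>A. f i x)"
  by (induction A rule: infinite_finite_induct) auto

lemma prod_fun_apply: "(\<Prod>i\<in>A. f i) x = (\<Prod>i\<in>A. f i x)"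
  by (induction A rule: infinite_finite_induct) auto

lemma power_fun_apply: "(f ^ n) x = f x ^ n"
  by (induction n) auto

lemma frac_mon_apply:
  "frac_mon \<alpha> U m x = (if x \<in> U then \<Prod>k\<in>UNIV. (x $ k powr \<alpha> / Gamma (1 + \<alpha>)) ^ m k else 0)"
  by (simp add: frac_mon_def prod_fun_apply power_fun_apply frac_X_def)

lemma frac_mon_mult: "frac_mon \<alpha> U m * frac_mon \<alpha> U n = frac_mon \<alpha> U (m + n)"
  by (auto simp: fun_eq_iff frac_mon_apply power_add prod.distrib)

text \<open>A polynomial function vanishing on a nondegenerate box has zero coefficients.\<close>

lemma polyfun_box_zero:
  fixes B :: "'n \<Rightarrow> real"
  assumes "finite A" and "\<And>i. 0 < B i" and "finite {m. c m \<noteq> 0}"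
    and "\<And>m i. c m \<noteq> 0 \<Longrightarrow> i \<notin> A \<Longrightarrow> m i = (0::nat)"
    and "\<And>y. (\<And>i. 0 \<le> y i \<and> y i \<le> B i) \<Longrightarrow> (\<Sum>m | c m \<noteq> 0. c m * (\<Prod>i\<in>A. y i ^ m i)) = (0::real)"
  shows "c m = 0"
  using assms(1,3-)
proof (induction A arbitrary: c m rule: finite_induct)
  case empty
  have *: "c m \<noteq> 0 \<Longrightarrow> m = (\<lambda>_. 0)" for m using empty(2) by auto
  show ?case
  proof (rule ccontr)
    assume "c m \<noteq> 0"
    then have "{m. c m \<noteq> 0} = {m}" using * by blast
    with empty(3)[of "\<lambda>_. 0"] assms(2) have "c m = 0" by (simp add: less_imp_le)
    with \<open>c m \<noteq> 0\<close> show False ..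
  qed
next
  case (insert a A)
  let ?S = "{m. c m \<noteq> 0}"
  obtain N where N: "\<And>m. c m \<noteq> 0 \<Longrightarrow> m a \<le> N"
    using finite_nat_set_iff_bounded_le[of "(\<lambda>m. m a) ` ?S"] insert.prems(1) by auto
  define C where "C k m = (if m a = 0 then c (m(a := k)) else 0)" for k m
  have inj: "inj_on (\<lambda>m. m(a := k)) {m. C k m \<noteq> 0}" for k
  proof (rule inj_onI)
    fix m n assume "m \<in> {m. C k m \<noteq> 0}" "n \<in> {m. C k m \<noteq> 0}" and eq: "m(a := k) = n(a := k)"
    then have "m a = 0" "n a = 0" by (auto simp: C_def split: if_splits)
    then show "m = n" using fun_cong[OF eq] by (metis ext fun_upd_other)
  qed
  have img: "(\<lambda>m. m(a := k)) ` {m. C k m \<noteq> 0} = {m \<in> ?S. m a = k}" for k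
  proof (intro equalityI subsetI)
    fix m assume "m \<in> {m \<in> ?S. m a = k}"
    then show "m \<in> (\<lambda>m. m(a := k)) ` {m. C k m \<noteq> 0}"
      by (intro image_eqI[of _ _ "m(a := 0)"]) (auto simp: C_def)
  qed (auto simp: C_def split: if_splits)
  have finC: "finite {m. C k m \<noteq> 0}" for k
    using finite_imageD[OF _ inj, of k] img[of k] insert.prems(1) by simp
  have Cz: "C k m = 0" for k m
  proof (rule insert.IH[OF finC])
    fix m i assume "C k m \<noteq> 0" "i \<notin> A"
    then show "m i = 0"
      using insert.prems(2)[of "m(a := k)" i] unfolding C_def
      by (cases "i = a") (auto simp del: fun_upd_apply simp: fun_upd_other split: if_splits)
  next
    fix y assume y: "\<And>i. 0 \<le> y i \<and> y i \<le> B i"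
    define d where "d k = (\<Sum>m | C k m \<noteq> 0. C k m * (\<Prod>i\<in>A. y i ^ m i))" for k
    have d_eq: "d k * t ^ k = (\<Sum>m \<in> {m \<in> ?S. m a = k}. c m * (t ^ m a * (\<Prod>i\<in>A. y i ^ m i)))" for k t
    proof -
      have "(\<Sum>m \<in> {m \<in> ?S. m a = k}. c m * (t ^ m a * (\<Prod>i\<in>A. y i ^ m i)))
        = (\<Sum>m | C k m \<noteq> 0. c (m(a:=k)) * (t ^ k * (\<Prod>i\<in>A. y i ^ (m(a:=k)) i)))"
        unfolding img[symmetric] by (subst sum.reindex[OF inj]) simp
      also have "\<dots> = (\<Sum>m | C k m \<noteq> 0. C k m * (\<Prod>i\<in>A. y i ^ m i) * t ^ k)"
      proof (rule sum.cong)
        fix m assume "m \<in> {m. C k m \<noteq> 0}"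
        moreover have "(\<Prod>i\<in>A. y i ^ (m(a:=k)) i) = (\<Prod>i\<in>A. y i ^ m i)"
          using insert.hyps by (intro prod.cong) auto
        ultimately show "c (m(a:=k)) * (t ^ k * (\<Prod>i\<in>A. y i ^ (m(a:=k)) i))
            = C k m * (\<Prod>i\<in>A. y i ^ m i) * t ^ k"
          by (auto simp: C_def split: if_splits)
      qed simp
      finally show ?thesis by (simp add: d_def sum_distrib_right)
    qed
    have "(\<Sum>k\<le>N. d k * t ^ k) = 0" if t: "0 \<le> t" "t \<le> B a" for t
    proof -
      have "(\<Sum>k\<le>N. d k * t ^ k) = (\<Sum>m\<in>?S. c m * (t ^ m a * (\<Prod>i\<in>A. y i ^ m i)))"
        unfolding d_eq by (rule sum.group) (use insert.prems(1) N in auto)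
      also have "\<dots> = (\<Sum>m\<in>?S. c m * (\<Prod>i\<in>insert a A. (y(a := t)) i ^ m i))"
      proof (rule sum.cong)
        fix m
        have "(\<Prod>i\<in>A. (y(a := t)) i ^ m i) = (\<Prod>i\<in>A. y i ^ m i)"
          using insert.hyps by (intro prod.cong) auto
        then show "c m * (t ^ m a * (\<Prod>i\<in>A. y i ^ m i)) = c m * (\<Prod>i\<in>insert a A. (y(a := t)) i ^ m i)"
          using insert.hyps by simp
      qed simp
      also have "\<dots> = 0" using y t by (intro insert.prems(3)) auto
      finally show ?thesis .
    qed
    then have "{0..B a} \<subseteq> {t. (\<Sum>k\<le>N. d k * t ^ k) = 0}" by auto
    moreover have "infinite {0..B a}" using assms(2)[of a] by (simp add: infinite_Icc)
    ultimately have "infinite {t. (\<Sum>k\<le>N. d k * t ^ k) = 0}" using finite_subset by blast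
    then have dz: "\<forall>k\<le>N. d k = 0" using polyfun_rootbound[of N d] by (metis (lifting))
    show "(\<Sum>m | C k m \<noteq> 0. C k m * (\<Prod>i\<in>A. y i ^ m i)) = 0"
    proof (cases "k \<le> N")
      case True then show ?thesis using dz by (simp add: d_def)
    next
      case False
      then have "{m. C k m \<noteq> 0} = {}" using N[of "_(a := k)"] by (force simp: C_def)
      then show ?thesis by simp
    qed
  qed
  show ?case using Cz[of "m a" "m(a := 0)"] by (simp add: C_def)
qed

lemma frac_lincomb_superset:
  assumes "finite S" "{m. c m \<noteq> 0} \<subseteq> S"
  shows "frac_lincomb \<alpha> U c x = (\<Sum>m\<in>S. c m * frac_mon \<alpha> U m x)"
  unfolding frac_lincomb_def using assms by (intro sum.mono_neutral_left) auto

lemma frac_lincomb_eq_0: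
  fixes b :: "real ^ 'n::finite"
  assumes "0 < \<alpha>" "\<And>i. 0 < b $ i" "finite {m. c m \<noteq> 0}" "frac_lincomb \<alpha> (cbox 0 b) c = 0"
  shows "c = 0"
proof
  fix m
  have G: "Gamma (1 + \<alpha>) > 0" using assms(1) by (intro Gamma_real_pos) simp
  have "c m = 0"
  proof (rule polyfun_box_zero[of UNIV "\<lambda>i. b $ i powr \<alpha> / Gamma (1 + \<alpha>)"])
    show "0 < b $ i powr \<alpha> / Gamma (1 + \<alpha>)" for i using G assms(2)[of i] by simp
    fix y assume y: "\<And>i. 0 \<le> y i \<and> y i \<le> b $ i powr \<alpha> / Gamma (1 + \<alpha>)"
    define x where "x = (\<chi> i. (y i * Gamma (1 + \<alpha>)) powr (1 / \<alpha>))"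
    have *: "x $ i powr \<alpha> / Gamma (1 + \<alpha>) = y i" for i
      using y[of i] assms(1) G[THEN less_imp_neq] by (simp add: x_def powr_powr)
    have "x $ i \<le> b $ i" for i
    proof -
      have "(y i * Gamma (1 + \<alpha>)) powr (1 / \<alpha>) \<le> (b $ i powr \<alpha>) powr (1 / \<alpha>)"
        using y[of i] G assms(1) by (intro powr_mono2) (auto simp: field_simps)
      then show ?thesis using assms(1) assms(2)[of i] by (simp add: x_def powr_powr less_imp_le)
    qed
    then have "x \<in> cbox 0 b" by (simp add: mem_box_cart x_def)
    with fun_cong[OF assms(4), of x] show "(\<Sum>m | c m \<noteq> 0. c m * (\<Prod>i\<in>UNIV. y i ^ m i)) = 0"
      by (simp add: frac_lincomb_def frac_mon_apply *)
  qed (use assms in auto)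
  then show "c m = 0 m" by simp
qed

lemma frac_lincomb_add:
  assumes "finite {m. c m \<noteq> 0}" "finite {m. d m \<noteq> 0}"
  shows "frac_lincomb \<alpha> U (c + d) = frac_lincomb \<alpha> U c + frac_lincomb \<alpha> U d"
proof
  fix x
  let ?S = "{m. c m \<noteq> 0} \<union> {m. d m \<noteq> 0}"
  have *: "frac_lincomb \<alpha> U e x = (\<Sum>m\<in>?S. e m * frac_mon \<alpha> U m x)" 
    if "{m. e m \<noteq> 0} \<subseteq> ?S" for e using frac_lincomb_superset that assms by blast
  have "{m. (c + d) m \<noteq> 0} \<subseteq> ?S" "{m. c m \<noteq> 0} \<subseteq> ?S" "{m. d m \<noteq> 0} \<subseteq> ?S" by auto
  note t = *[of "c + d", OF this(1)] *[of c, OF this(2)] *[of d, OF this(3)]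
  show "frac_lincomb \<alpha> U (c + d) x = (frac_lincomb \<alpha> U c + frac_lincomb \<alpha> U d) x"
    unfolding plus_fun_apply t by (simp add: sum.distrib distrib_right)
qed

lemma frac_lincomb_scale:
  "frac_lincomb \<alpha> U (\<lambda>m. r * c m) = (\<lambda>x. r * frac_lincomb \<alpha> U c x)"
  by (cases "r = 0") (simp_all add: frac_lincomb_def fun_eq_iff sum_distrib_left mult.assoc)

lemma frac_lincomb_single:
  "frac_lincomb \<alpha> U (\<lambda>n. if n = m then 1 else 0) = frac_mon \<alpha> U m"
proof
  fix x
  show "frac_lincomb \<alpha> U (\<lambda>n. if n = m then 1 else 0) x = frac_mon \<alpha> U m x"
    by (subst frac_lincomb_superset[of "{m}"]) auto
qed

lemma frac_coeffs_unique:
  fixes b :: "real ^ 'n::finite"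
  assumes "0 < \<alpha>" "\<And>i. 0 < b $ i" "f \<in> frac_poly \<alpha> (cbox 0 b)"
  shows "\<exists>!c. finite {m. c m \<noteq> 0} \<and> f = frac_lincomb \<alpha> (cbox 0 b) c"
proof (rule ex_ex1I)
  let ?U = "cbox 0 b"
  let ?Q = "\<lambda>f. \<exists>c. finite {m. c m \<noteq> 0} \<and> f = frac_lincomb \<alpha> ?U c"
  have Qadd: "?Q (f + g)" if "?Q f" "?Q g" for f g
  proof -
    from that obtain c d where cd: "finite {m. c m \<noteq> 0}" "finite {m. d m \<noteq> 0}"
      "f = frac_lincomb \<alpha> ?U c" "g = frac_lincomb \<alpha> ?U d" by auto
    have "finite {m. (c + d) m \<noteq> 0}"
      by (rule finite_subset[OF _ finite_UnI[OF cd(1,2)]]) auto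
    with cd frac_lincomb_add[OF cd(1,2), of \<alpha> ?U] show ?thesis by (intro exI[of _ "c + d"]) simp
  qed
  have Qscale: "?Q (\<lambda>x. r * f x)" if "?Q f" for f r
  proof -
    from that obtain c where c: "finite {m. c m \<noteq> 0}" "f = frac_lincomb \<alpha> ?U c" by auto
    have "finite {m. r * c m \<noteq> 0}" by (rule finite_subset[OF _ c(1)]) auto
    with c frac_lincomb_scale[of \<alpha> ?U r c] show ?thesis by (intro exI[of _ "\<lambda>m. r * c m"]) simp
  qed
  have Qmon: "?Q (frac_mon \<alpha> ?U m)" for m
    by (intro exI[of _ "\<lambda>n. if n = m then 1 else 0"]) (simp add: frac_lincomb_single)
  have Q0: "?Q 0" by (intro exI[of _ 0]) (simp add: frac_lincomb_def zero_fun_def)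
  have Qsum: "finite A \<Longrightarrow> (\<And>i. i \<in> A \<Longrightarrow> ?Q (F i)) \<Longrightarrow> ?Q (\<Sum>i\<in>A. F i)"
    for A :: "('n \<Rightarrow> nat) set" and F
  proof (induction A rule: finite_induct)
    case empty show ?case using Q0 by (simp only: sum.empty)
  next
    case (insert a A)
    have "?Q (F a + (\<Sum>i\<in>A. F i))" by (rule Qadd) (use insert in blast)+
    then show ?case by (simp only: sum.insert[OF insert.hyps])
  qed
  show "?Q f" using assms(3)
  proof induction
    case (const r)
    have "(\<lambda>x. if x \<in> ?U then r else 0) = (\<lambda>x. r * frac_mon \<alpha> ?U 0 x)"
      by (auto simp: frac_mon_apply fun_eq_iff)
    then show ?case using Qscale[OF Qmon, of r 0] by simp
  next
    case (gen i)
    have "(\<Prod>k\<in>UNIV. (x $ k powr \<alpha> / Gamma (1 + \<alpha>)) ^ (if k = i then 1 else 0)) = x $ i powr \<alpha> / Gamma (1 + \<alpha>)" for x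
      by (subst prod.remove[of _ i]) auto
    then have "frac_X \<alpha> ?U i = frac_mon \<alpha> ?U (\<lambda>k. if k = i then 1 else 0)"
      by (auto simp: frac_mon_apply fun_eq_iff frac_X_def)
    then show ?case using Qmon by simp
  next
    case (add f g) then show ?case using Qadd by blast
  next
    case (mult f g)
    then obtain c d where cd: "finite {m. c m \<noteq> 0}" "finite {m. d m \<noteq> 0}"
      "f = frac_lincomb \<alpha> ?U c" "g = frac_lincomb \<alpha> ?U d" by auto
    have "f * g = (\<Sum>m | c m \<noteq> 0. \<Sum>n | d n \<noteq> 0. (\<lambda>x. (c m * d n) * frac_mon \<alpha> ?U (m + n) x))"
      by (auto simp: cd fun_eq_iff sum_fun_apply frac_lincomb_def sum_product frac_mon_mult[symmetric] algebra_simps intro!: sum.cong)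
    then show ?case using cd by (simp only:) (intro Qsum Qscale Qmon; simp)
  qed
next
  let ?U = "cbox 0 b"
  fix c d
  assume *: "finite {m. c m \<noteq> 0} \<and> f = frac_lincomb \<alpha> ?U c" "finite {m. d m \<noteq> 0} \<and> f = frac_lincomb \<alpha> ?U d"
  define e where "e = (\<lambda>m. (-1) * d m)"
  have fe: "finite {m. e m \<noteq> 0}" using * by (simp add: e_def)
  have "frac_lincomb \<alpha> ?U (c + e) = 0"
    unfolding frac_lincomb_add[OF conjunct1[OF *(1)] fe] unfolding e_def frac_lincomb_scale
    using * by (simp add: fun_eq_iff)
  moreover have "finite {m. (c + e) m \<noteq> 0}"
    by (rule finite_subset[OF _ finite_UnI[OF conjunct1[OF *(1)] fe]]) auto
  ultimately have "c + e = 0" using frac_lincomb_eq_0 assms by blast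
  then show "c = d" by (simp add: e_def fun_eq_iff)
qed


lemma frac_coeffs_lincomb:
  fixes b :: "real ^ 'n::finite"
  assumes "0 < \<alpha>" "\<And>i. 0 < b $ i" "finite {m. c m \<noteq> 0}"
  shows "frac_coeffs \<alpha> (cbox 0 b) (frac_lincomb \<alpha> (cbox 0 b) c) = c"
  unfolding frac_coeffs_def
proof (rule the_equality)
  fix d assume d: "finite {m. d m \<noteq> 0} \<and> frac_lincomb \<alpha> (cbox 0 b) c = frac_lincomb \<alpha> (cbox 0 b) d"
  define e where "e = (\<lambda>m. (-1) * d m)"
  have fe: "finite {m. e m \<noteq> 0}" using d by (simp add: e_def)
  have "frac_lincomb \<alpha> (cbox 0 b) (c + e) = 0"
    unfolding frac_lincomb_add[OF assms(3) fe] unfolding e_def frac_lincomb_scale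
    using d by (simp add: fun_eq_iff)
  moreover have "finite {m. (c + e) m \<noteq> 0}"
    by (rule finite_subset[OF _ finite_UnI[OF assms(3) fe]]) auto
  ultimately have "c + e = 0" using frac_lincomb_eq_0 assms by blast
  then show "d = c" by (simp add: e_def fun_eq_iff)
qed (use assms in simp)

lemma caputo_frac_mon:
  fixes b :: "real ^ 'n::finite"
  assumes "0 < \<alpha>" "\<And>i. 0 < b $ i"
  shows "caputo \<alpha> (cbox 0 b) i (frac_mon \<alpha> (cbox 0 b) m) = caputo_mon \<alpha> (cbox 0 b) i m"
proof -
  have "frac_coeffs \<alpha> (cbox 0 b) (frac_mon \<alpha> (cbox 0 b) m) = (\<lambda>n. if n = m then 1 else 0)"
    using frac_coeffs_lincomb[of \<alpha> b "\<lambda>n. if n = m then 1 else 0"] assms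
    by (simp add: frac_lincomb_single)
  then show ?thesis by (simp add: caputo_def)
qed

lemma caputo_linear:
  fixes b :: "real ^ 'n::finite"
  assumes "0 < \<alpha>" "\<And>i. 0 < b $ i" "f \<in> frac_poly \<alpha> (cbox 0 b)" "g \<in> frac_poly \<alpha> (cbox 0 b)"
  shows "caputo \<alpha> (cbox 0 b) i (\<lambda>x. r * f x + s * g x) =
    (\<lambda>x. r * caputo \<alpha> (cbox 0 b) i f x + s * caputo \<alpha> (cbox 0 b) i g x)"
proof -
  let ?U = "cbox 0 b"
  obtain c d where cd: "finite {m. c m \<noteq> 0}" "finite {m. d m \<noteq> 0}"
    "f = frac_lincomb \<alpha> ?U c" "g = frac_lincomb \<alpha> ?U d"
    using frac_coeffs_unique[OF assms(1,2,3)] frac_coeffs_unique[OF assms(1,2,4)] by blast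
  let ?S = "{m. c m \<noteq> 0} \<union> {m. d m \<noteq> 0}"
  have fin: "finite {m. r * c m \<noteq> 0}" "finite {m. s * d m \<noteq> 0}"
    using cd by (auto intro: finite_subset[OF _ cd(1)] finite_subset[OF _ cd(2)])
  define e where "e = (\<lambda>m. r * c m) + (\<lambda>m. s * d m)"
  have e: "{m. e m \<noteq> 0} \<subseteq> ?S" by (auto simp: e_def)
  then have fe: "finite {m. e m \<noteq> 0}" using cd finite_subset by blast
  have eq: "(\<lambda>x. r * f x + s * g x) = frac_lincomb \<alpha> ?U e"
    unfolding e_def frac_lincomb_add[OF fin] unfolding frac_lincomb_scale cd by (simp add: fun_eq_iff)
  have *: "caputo \<alpha> ?U i (frac_lincomb \<alpha> ?U u) x = (\<Sum>m\<in>?S. u m * caputo_mon \<alpha> ?U i m x)"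
    if "{m. u m \<noteq> 0} \<subseteq> ?S" for u x
  proof -
    have fu: "finite {m. u m \<noteq> 0}" using that cd finite_subset by blast
    show ?thesis unfolding caputo_def frac_coeffs_lincomb[OF assms(1,2) fu]
      using that cd by (intro sum.mono_neutral_left) auto
  qed
  have "{m. c m \<noteq> 0} \<subseteq> ?S" "{m. d m \<noteq> 0} \<subseteq> ?S" by auto
  then show ?thesis unfolding eq unfolding cd(3,4)
    by (simp only: * e fun_eq_iff) (simp add: e_def sum.distrib sum_distrib_left algebra_simps)
qed

lemma frac_poly_sum:
  assumes "finite A" "\<And>i. i \<in> A \<Longrightarrow> f i \<in> frac_poly \<alpha> U"
  shows "(\<Sum>i\<in>A. f i) \<in> frac_poly \<alpha> U"
  using assms
proof (induction A rule: finite_induct)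
  case empty
  then show ?case using frac_poly.const[of U 0 \<alpha>] by (simp add: zero_fun_def)
qed (auto intro: frac_poly.add)

lemma frac_poly_scale:
  assumes "f \<in> frac_poly \<alpha> U"
  shows "(\<lambda>x. r * f x) \<in> frac_poly \<alpha> U"
proof -
  have "f x = 0" if "x \<notin> U" for x using assms that by induction (auto simp: frac_X_def)
  then have "(\<lambda>x. if x \<in> U then r else 0) * f = (\<lambda>x. r * f x)" by (auto simp: fun_eq_iff)
  then show ?thesis using frac_poly.mult[OF frac_poly.const[of U r \<alpha>] assms] by simp
qed

lemma frac_mon_in_poly: "frac_mon \<alpha> U m \<in> frac_poly \<alpha> U"
proof -
  have 1: "indicator U \<in> frac_poly \<alpha> U"
    using frac_poly.const[of U 1 \<alpha>] by (simp add: indicator_def[abs_def] of_bool_def)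
  have pow: "f * g ^ k \<in> frac_poly \<alpha> U" if "f \<in> frac_poly \<alpha> U" "g \<in> frac_poly \<alpha> U" for f g k
  proof (induction k)
    case (Suc k)
    have "f * g ^ Suc k = g * (f * g ^ k)" by (simp only: power_Suc mult.left_commute)
    then show ?case using frac_poly.mult[OF that(2) Suc] by (simp only:)
  qed (use that in simp)
  have "indicator U * (\<Prod>k\<in>A. frac_X \<alpha> U k ^ m k) \<in> frac_poly \<alpha> U" if "finite A" for A
    using that
  proof (induction A rule: finite_induct)
    case empty then show ?case using 1 by simp
  next
    case (insert a A)
    have "indicator U * (\<Prod>k\<in>insert a A. frac_X \<alpha> U k ^ m k) =
      (indicator U * (\<Prod>k\<in>A. frac_X \<alpha> U k ^ m k)) * frac_X \<alpha> U a ^ m a"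
      by (simp only: prod.insert[OF insert.hyps] ac_simps)
    then show ?case using pow[OF insert.IH frac_poly.gen] by (simp only:)
  qed
  then show ?thesis by (simp add: frac_mon_def)
qed

lemma caputo_in_poly: "caputo \<alpha> U i f \<in> frac_poly \<alpha> U"
proof -
  have z: "0 \<in> frac_poly \<alpha> U" using frac_poly.const[of U 0 \<alpha>] by (simp add: zero_fun_def)
  have "caputo_mon \<alpha> U i m \<in> frac_poly \<alpha> U" for m
  proof (cases "m i = 0")
    case True
    then show ?thesis using z by (simp only: caputo_mon_def refl if_True)
  next
    case False
    then show ?thesis by (simp only: caputo_mon_def if_False frac_poly_scale frac_mon_in_poly)
  qed
  moreover have "caputo \<alpha> U i f =
    (\<Sum>m | frac_coeffs \<alpha> U f m \<noteq> 0. (\<lambda>x. frac_coeffs \<alpha> U f m * caputo_mon \<alpha> U i m x))"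
    by (simp add: caputo_def fun_eq_iff sum_fun_apply)
  ultimately show ?thesis
    by (cases "finite {m. frac_coeffs \<alpha> U f m \<noteq> 0}") (auto intro: frac_poly_sum frac_poly_scale simp: z)
qed

subsection \<open>Relations between the generators, and degree of the differential\<close>

lemma form_wedge_dXs:
  fixes I J :: "'a::{finite, linorder} set"
  shows "form_dXs U I \<and>\<^sub>F form_dXs U J =
    (if I \<inter> J = {} then shuffle_sign I J * form_dXs U (I \<union> J) else 0)"
proof
  fix K
  have "(form_dXs U I \<and>\<^sub>F form_dXs U J) K =
    (\<Sum>L\<in>Pow K. if L = I then shuffle_sign I (K - I) * indicator U * form_dXs U J (K - I) else 0)"
    unfolding form_wedge_def by (intro sum.cong) (auto simp: form_dXs_def)
  also have "\<dots> = (if I \<subseteq> K \<and> K - I = J then shuffle_sign I J * indicator U * indicator U else 0)"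
    by (subst sum.delta) (auto simp: form_dXs_def)
  also have "\<dots> = (if I \<inter> J = {} then shuffle_sign I J * form_dXs U (I \<union> J) else 0) K"
  proof -
    have "indicator U * (indicator U :: (real, 'a) vec \<Rightarrow> real) = indicator U" by (auto simp: fun_eq_iff indicator_def)
    moreover have "(shuffle_sign I J :: 'a set \<Rightarrow> (real, 'a) vec \<Rightarrow> real) K = shuffle_sign I J"
      by (simp add: shuffle_sign_def power_fun_apply)
    ultimately show ?thesis by (auto simp: form_dXs_def mult.assoc)
  qed
  finally show "(form_dXs U I \<and>\<^sub>F form_dXs U J) K = \<dots>" .
qed

lemma form_dX_anticommute: "form_dX U i \<and>\<^sub>F form_dX U j = - (form_dX U j \<and>\<^sub>F form_dX U i)"
proof -
  have *: "{(i', j'). i' = i \<and> j' = j \<and> j' < i'} = (if j < i then {(i, j)} else {})" for i j :: 'a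
    by auto
  show ?thesis
    by (cases i j rule: linorder_cases)
      (auto simp: form_wedge_dXs shuffle_sign_def * insert_commute)
qed

lemma form_dX_square: "form_dX U i \<and>\<^sub>F form_dX U i = 0"
  by (simp add: form_wedge_dXs)

lemma form_dXs_increasing:
  assumes "\<And>j. j \<in> I \<Longrightarrow> i < j"
  shows "form_dXs U (insert i I) = form_dX U i \<and>\<^sub>F form_dXs U I"
proof -
  have "{(i', j). i' \<in> {i} \<and> j \<in> I \<and> j < i'} = {}" "i \<notin> I" using assms by force+
  then show ?thesis by (simp only: form_wedge_dXs shuffle_sign_def) simp
qed

lemma frac_d_in_forms:
  fixes U :: "(real ^ 'a::{finite, linorder}) set"
  shows "frac_d \<alpha> U p \<omega> \<in> frac_forms \<alpha> U (Suc p)"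
proof -
  have z: "0 \<in> frac_poly \<alpha> U" using frac_poly.const[of U 0 \<alpha>] by (simp add: zero_fun_def)
  have s: "shuffle_sign I J * f \<in> frac_poly \<alpha> U" if "f \<in> frac_poly \<alpha> U" for I J :: "'a set" and f
  proof -
    have "shuffle_sign I J * f = (\<lambda>x. shuffle_sign I J * f x)"
      by (simp add: fun_eq_iff shuffle_sign_def power_fun_apply)
    then show ?thesis using frac_poly_scale[OF that] by simp
  qed
  have 1: "indicator U \<in> frac_poly \<alpha> U"
    using frac_poly.const[of U 1 \<alpha>] by (simp add: indicator_def[abs_def] of_bool_def)
  have K: "(shuffle_sign I J :: 'a set \<Rightarrow> (real, 'a) vec \<Rightarrow> real) K = shuffle_sign I J" for I J :: "'a set" and K
    by (simp add: shuffle_sign_def power_fun_apply)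
  have W: "(form_dX U i \<and>\<^sub>F form_dXs U I) K =
    (if i \<notin> I \<and> K = insert i I then shuffle_sign {i} I * indicator U else 0)" for i I K
    by (simp add: form_wedge_dXs K) (simp add: form_dXs_def)
  show ?thesis
    unfolding frac_forms_def frac_d_def
    by (auto simp: sum_fun_apply form_scale_def W
        intro!: frac_poly_sum frac_poly.mult caputo_in_poly s z 1 sum.neutral)
qed

end

theory Submission
  imports Defs
begin

text \<open>
  As for the classical exterior differential, \<open>d \<circ> d\<close> vanishes because the second partial
  derivatives are symmetric in \<open>i\<close> and \<open>j\<close> whereas \<open>dX\<^sub>i \<and> dX\<^sub>j\<close> is antisymmetric.

  \<^item> The Caputo operators commute (\<open>caputo_commute\<close>). By linearity this need only be seen on
    monomials. There the factor produced by \<open>D\<^sub>i\<close> depends on the \<open>i\<close>-th exponent alone, and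
    for \<open>i \<noteq> j\<close> the operator \<open>D\<^sub>j\<close> leaves that exponent alone; so both orders produce the
    product of the same two factors.

  \<^item> The coefficient of \<open>dX\<^sub>K\<close> in \<open>d\<omega>\<close> is the sum over \<open>i \<in> K\<close> of
    \<open>\<epsilon>(i, K - i) D\<^sub>i \<omega>\<^bsub>K - i\<^esub>\<close>, where \<open>\<epsilon>(i, J)\<close> is the sign of moving \<open>i\<close> to its place in
    \<open>J\<close> (\<open>frac_d_apply\<close>). Hence the coefficient of \<open>dX\<^sub>K\<close> in \<open>d(d\<omega>)\<close> is a sum over ordered
    pairs \<open>i \<noteq> j\<close> in \<open>K\<close> of \<open>\<epsilon>(i, K - i) \<epsilon>(j, K - i - j) D\<^sub>i D\<^sub>j \<omega>\<^bsub>K - i - j\<^esub>\<close>. Exchanging \<open>i\<close>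
    and \<open>j\<close> reverses the product of the signs (\<open>shuffle_sign_exchange\<close>), so the terms cancel
    in pairs.
\<close>

lemma frac_poly_outside:
  assumes "f \<in> frac_poly \<alpha> U" "x \<notin> U"
  shows "f x = 0"
  using assms by induction (auto simp: frac_X_def)

lemma caputo_scale:
  fixes b :: "real ^ 'n::finite"
  assumes "0 < \<alpha>" "\<And>i. 0 < b $ i" "f \<in> frac_poly \<alpha> (cbox 0 b)"
  shows "caputo \<alpha> (cbox 0 b) i (\<lambda>x. r * f x) = (\<lambda>x. r * caputo \<alpha> (cbox 0 b) i f x)"
  using caputo_linear[OF assms assms(3), of i r 0] by simp

lemma caputo_sum:
  fixes b :: "real ^ 'n::finite"
  assumes "0 < \<alpha>" "\<And>i. 0 < b $ i" "finite A" "\<And>a. a \<in> A \<Longrightarrow> f a \<in> frac_poly \<alpha> (cbox 0 b)"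
  shows "caputo \<alpha> (cbox 0 b) i (\<lambda>x. \<Sum>a\<in>A. r a * f a x) =
    (\<lambda>x. \<Sum>a\<in>A. r a * caputo \<alpha> (cbox 0 b) i (f a) x)"
  using assms(3,4)
proof (induction A rule: finite_induct)
  case empty
  show ?case
    using caputo_scale[OF assms(1,2) frac_mon_in_poly, where r = 0] by simp
next
  case (insert a A)
  have "(\<lambda>x. \<Sum>a\<in>A. r a * f a x) = (\<Sum>a\<in>A. (\<lambda>x. r a * f a x))"
    by (simp add: fun_eq_iff sum_fun_apply)
  also have "\<dots> \<in> frac_poly \<alpha> (cbox 0 b)"
    using insert by (intro frac_poly_sum frac_poly_scale) auto
  finally have "(\<lambda>x. \<Sum>a\<in>A. r a * f a x) \<in> frac_poly \<alpha> (cbox 0 b)" .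
  with caputo_linear[OF assms(1,2) insert.prems[of a] this, of i "r a" 1] insert
  show ?case by simp
qed

definition caputo_factor :: "real \<Rightarrow> nat \<Rightarrow> real" where
  "caputo_factor \<alpha> k = (if k = 0 then 0
    else Gamma (real k * \<alpha> + 1) / (Gamma ((real k - 1) * \<alpha> + 1) * Gamma (1 + \<alpha>)))"

text \<open>
  Setting the factor to zero at exponent zero merges the two cases of the operator on monomials,
  so that the commutation on monomials needs no case distinction on the exponents.
\<close>

lemma caputo_mon_factor:
  "caputo_mon \<alpha> U i m = (\<lambda>x. caputo_factor \<alpha> (m i) * frac_mon \<alpha> U (m(i := m i - 1)) x)"
  by (simp add: caputo_mon_def caputo_factor_def fun_eq_iff)

lemma caputo_commute_mon:
  fixes b :: "real ^ 'n::finite"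
  assumes "0 < \<alpha>" "\<And>i. 0 < b $ i"
  shows "caputo \<alpha> (cbox 0 b) i (caputo \<alpha> (cbox 0 b) j (frac_mon \<alpha> (cbox 0 b) m)) =
    caputo \<alpha> (cbox 0 b) j (caputo \<alpha> (cbox 0 b) i (frac_mon \<alpha> (cbox 0 b) m))"
proof (cases "i = j")
  case False
  then show ?thesis
    by (simp add: caputo_frac_mon[OF assms] caputo_mon_factor caputo_scale[OF assms frac_mon_in_poly]
        fun_upd_twist[OF False] mult_ac)
qed simp

lemma caputo_commute:
  fixes b :: "real ^ 'n::finite"
  assumes "0 < \<alpha>" "\<And>i. 0 < b $ i" "f \<in> frac_poly \<alpha> (cbox 0 b)"
  shows "caputo \<alpha> (cbox 0 b) i (caputo \<alpha> (cbox 0 b) j f) =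
    caputo \<alpha> (cbox 0 b) j (caputo \<alpha> (cbox 0 b) i f)"
proof -
  let ?U = "cbox 0 b"
  obtain c where c: "finite {m. c m \<noteq> 0}" "f = frac_lincomb \<alpha> ?U c"
    using frac_coeffs_unique[OF assms] by blast
  have "caputo \<alpha> ?U k (caputo \<alpha> ?U l f) =
      (\<lambda>x. \<Sum>m | c m \<noteq> 0. c m * caputo \<alpha> ?U k (caputo \<alpha> ?U l (frac_mon \<alpha> ?U m)) x)" for k l
    unfolding c(2) frac_lincomb_def
    by (simp add: caputo_sum[OF assms(1,2) c(1)] frac_mon_in_poly caputo_in_poly)
  then show ?thesis by (simp add: caputo_commute_mon[OF assms(1,2), of i j])
qed

lemma shuffle_sign_insert:
  fixes I J :: "'n::{finite, linorder} set"
  assumes "j \<notin> J"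
  shows "(shuffle_sign I (insert j J) :: 'a::comm_ring_1) = shuffle_sign I {j} * shuffle_sign I J"
proof -
  have "{(i, k). i \<in> I \<and> k \<in> insert j J \<and> k < i} =
      {(i, k). i \<in> I \<and> k \<in> {j} \<and> k < i} \<union> {(i, k). i \<in> I \<and> k \<in> J \<and> k < i}" (is "?A = ?B \<union> ?C")
    by auto
  moreover have "?B \<inter> ?C = {}" using assms by auto
  ultimately have "card ?A = card ?B + card ?C"
    by (simp only: card_Un_disjoint finite)
  then show ?thesis by (simp only: shuffle_sign_def power_add)
qed

lemma shuffle_sign_singletons: "shuffle_sign {i} {j} = (if j < i then - 1 else 1)"
proof -
  have "{(i', j'). i' \<in> {i} \<and> j' \<in> {j} \<and> j' < i'} = (if j < i then {(i, j)} else {})"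
    by auto
  then show ?thesis by (simp only: shuffle_sign_def) simp
qed

text \<open>
  Both products of signs contain the signs of \<open>i\<close> and \<open>j\<close> against the rest of \<open>K\<close>. They differ
  only in the sign of \<open>i\<close> against \<open>j\<close>, which is present in one order and replaced in the other by
  the opposite sign of \<open>j\<close> against \<open>i\<close>.
\<close>

lemma shuffle_sign_exchange:
  fixes K :: "'n::{finite, linorder} set"
  assumes "i \<in> K" "j \<in> K" "i \<noteq> j"
  shows "shuffle_sign {i} (K - {i}) * shuffle_sign {j} (K - {i} - {j}) =
    - (shuffle_sign {j} (K - {j}) * shuffle_sign {i} (K - {j} - {i}) :: 'a::comm_ring_1)"
proof -
  define L where "L = K - {i} - {j}"
  have L: "K - {i} = insert j L" "K - {j} = insert i L"
      "insert j L - {j} = L" "insert i L - {i} = L" "i \<notin> L" "j \<notin> L"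
    using assms by (auto simp: L_def)
  have swap: "shuffle_sign {i} {j} = (- shuffle_sign {j} {i} :: 'a)"
    using assms(3) by (cases i j rule: linorder_cases) (simp_all add: shuffle_sign_singletons)
  show ?thesis
    unfolding L(1,2) L(3,4) shuffle_sign_insert[OF L(5)] shuffle_sign_insert[OF L(6)]
    by (simp only: swap) (simp add: algebra_simps)
qed

text \<open>
  Only the pairs \<open>(i, I)\<close> with \<open>i \<in> K\<close> and \<open>I = K - {i}\<close> contribute to the coefficient of \<open>dX\<^sub>K\<close>; the
  factor \<open>indicator U\<close> coming from the basis forms is absorbed since the Caputo derivatives
  vanish outside \<open>U\<close>.
\<close>

lemma frac_d_apply:
  fixes U :: "(real ^ 'n::{finite, linorder}) set"
  shows "frac_d \<alpha> U p \<omega> K =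
    (if card K = Suc p
     then (\<lambda>x. \<Sum>i\<in>K. shuffle_sign {i} (K - {i}) * caputo \<alpha> U i (\<omega> (K - {i})) x) else 0)"
proof (cases "card K = Suc p")
  case False
  then show ?thesis using frac_d_in_forms[of \<alpha> U p \<omega>] by (simp add: frac_forms_def)
next
  case True
  have sign: "(shuffle_sign I J :: 'n frac_form) L x = shuffle_sign I J" for I J L :: "'n set" and x
    by (simp add: shuffle_sign_def power_fun_apply)
  have basis: "(form_dX U i \<and>\<^sub>F form_dXs U I) K x =
      (if i \<in> K \<and> I = K - {i} then shuffle_sign {i} I * indicator U x else 0)" for i I x
    by (cases "i \<in> I"; simp add: form_wedge_dXs sign; auto simp: form_dXs_def)
  have W: "form_scale (caputo \<alpha> U i (\<omega> I)) (form_dX U i \<and>\<^sub>F form_dXs U I) K x =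
      (if I = K - {i} then if i \<in> K then shuffle_sign {i} (K - {i}) * caputo \<alpha> U i (\<omega> (K - {i})) x
        else 0 else 0)" for i I x
    using frac_poly_outside[OF caputo_in_poly, of x U \<alpha> i "\<omega> I"]
    by (cases "x \<in> U") (auto simp: form_scale_def basis)
  show ?thesis
  proof
    fix x
    have "frac_d \<alpha> U p \<omega> K x = (\<Sum>i\<in>UNIV. \<Sum>I | card I = p.
        if I = K - {i} then if i \<in> K then shuffle_sign {i} (K - {i}) * caputo \<alpha> U i (\<omega> (K - {i})) x
        else 0 else 0)"
      by (subst sum.swap) (simp add: frac_d_def sum_fun_apply W)
    also have "\<dots> = (\<Sum>i\<in>UNIV. if i \<in> K
        then shuffle_sign {i} (K - {i}) * caputo \<alpha> U i (\<omega> (K - {i})) x else 0)"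
      using True by (intro sum.cong refl) simp
    also have "\<dots> = (\<Sum>i\<in>K. shuffle_sign {i} (K - {i}) * caputo \<alpha> U i (\<omega> (K - {i})) x)"
      by (simp flip: sum.inter_restrict)
    finally show "frac_d \<alpha> U p \<omega> K x = (if card K = Suc p
      then (\<lambda>x. \<Sum>i\<in>K. shuffle_sign {i} (K - {i}) * caputo \<alpha> U i (\<omega> (K - {i})) x) else 0) x"
      using True by simp
  qed
qed

lemma sum_antisymmetric_eq_0:
  fixes F :: "'a \<Rightarrow> 'a \<Rightarrow> real"
  assumes "finite A" "\<And>i j. i \<in> A \<Longrightarrow> j \<in> A \<Longrightarrow> i \<noteq> j \<Longrightarrow> F i j = - F j i"
  shows "(\<Sum>i\<in>A. \<Sum>j\<in>A - {i}. F i j) = 0"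
proof -
  \<comment> \<open>Filling the diagonal with zeros makes the index set a product, so that the order of
    summation can be exchanged.\<close>
  define G where "G i j = (if i = j then 0 else F i j)" for i j
  have "(\<Sum>i\<in>A. \<Sum>j\<in>A - {i}. F i j) = (\<Sum>i\<in>A. \<Sum>j\<in>A. G i j)"
    using assms(1) by (simp add: G_def if_distrib sum.If_cases Collect_neg_eq Diff_eq)
  moreover have "(\<Sum>i\<in>A. \<Sum>j\<in>A. G i j) = - (\<Sum>i\<in>A. \<Sum>j\<in>A. G i j)"
  proof -
    have "(\<Sum>i\<in>A. \<Sum>j\<in>A. G i j) = (\<Sum>j\<in>A. \<Sum>i\<in>A. G i j)"
      by (rule sum.swap)
    also have "\<dots> = (\<Sum>j\<in>A. \<Sum>i\<in>A. - G j i)"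
    proof (intro sum.cong refl)
      fix i j assume "i \<in> A" "j \<in> A"
      then show "G i j = - G j i" using assms(2)[of i j] by (cases "i = j") (simp_all add: G_def)
    qed
    also have "\<dots> = - (\<Sum>j\<in>A. \<Sum>i\<in>A. G j i)"
      by (simp only: sum_negf)
    finally show ?thesis .
  qed
  ultimately show ?thesis by linarith
qed

theorem theorem6p1:
  fixes \<alpha> :: real and b :: "real ^ 'n::{finite, linorder}" and p :: nat
    and \<omega> :: "'n frac_form"
  assumes "0 < \<alpha>" and "\<alpha> < 1" and "\<And>i. 0 < b $ i"
    and "\<omega> \<in> frac_forms \<alpha> (cbox 0 b) p"
  shows "frac_d \<alpha> (cbox 0 b) (Suc p) (frac_d \<alpha> (cbox 0 b) p \<omega>) = 0"
proof (intro ext)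
  fix K x
  let ?U = "cbox 0 b" and ?D = "caputo \<alpha> (cbox 0 b)"
  have poly: "\<omega> I \<in> frac_poly \<alpha> ?U" for I using assms(4) by (simp add: frac_forms_def)
  show "frac_d \<alpha> ?U (Suc p) (frac_d \<alpha> ?U p \<omega>) K x = 0 K x"
  proof (cases "card K = Suc (Suc p)")
    case True
    have D: "?D i (frac_d \<alpha> ?U p \<omega> (K - {i})) =
        (\<lambda>x. \<Sum>j\<in>K - {i}. shuffle_sign {j} (K - {i} - {j}) * ?D i (?D j (\<omega> (K - {i} - {j}))) x)"
      if "i \<in> K" for i
      using that True
      by (simp add: frac_d_apply caputo_sum[OF assms(1,3)] caputo_in_poly)
    have "frac_d \<alpha> ?U (Suc p) (frac_d \<alpha> ?U p \<omega>) K x =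
        (\<Sum>i\<in>K. shuffle_sign {i} (K - {i}) * ?D i (frac_d \<alpha> ?U p \<omega> (K - {i})) x)"
      by (subst frac_d_apply) (simp add: True)
    also have "\<dots> = (\<Sum>i\<in>K. \<Sum>j\<in>K - {i}. shuffle_sign {i} (K - {i}) * shuffle_sign {j} (K - {i} - {j}) *
        ?D i (?D j (\<omega> (K - {i} - {j}))) x)"
      by (simp add: D sum_distrib_left mult.assoc)
    also have "\<dots> = 0"
    proof (rule sum_antisymmetric_eq_0)
      fix i j assume ij: "i \<in> K" "j \<in> K" "i \<noteq> j"
      have "?D i (?D j (\<omega> (K - {i} - {j}))) = ?D j (?D i (\<omega> (K - {j} - {i})))"
        using caputo_commute[OF assms(1,3) poly] by (simp add: Diff_insert2[symmetric] insert_commute)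
      then show "shuffle_sign {i} (K - {i}) * shuffle_sign {j} (K - {i} - {j}) *
          ?D i (?D j (\<omega> (K - {i} - {j}))) x =
        - (shuffle_sign {j} (K - {j}) * shuffle_sign {i} (K - {j} - {i}) *
          ?D j (?D i (\<omega> (K - {j} - {i}))) x)"
        by (simp only: shuffle_sign_exchange[OF ij] mult_minus_left)
    qed simp
    finally show ?thesis by simp
  qed (simp add: frac_d_apply)
qed

end
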